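(* Assume in addition to the standing assumptions in the context that $h$ satisfies the Polyak-Lojasiewicz condition: there is a constant $\mu_h>0$ with $\frac12\|\nabla h(\theta)\|^2\ge\mu_h(h(\theta)-h^\star)$ for all $\theta\in\mathbb{R}^d$. Let the step sizes be $$\lambda_k=\frac{c_\lambda}{k+\tau+1},\qquad \alpha_k=\frac{c_\alpha}{k+\tau+1},\qquad \beta_k=\frac{c_\beta}{k+\tau+1},$$ where $c_\lambda,c_\alpha,c_\beta>0$ and $\tau\ge1$ are constants such that $c_\alpha\ge\frac{2}{\min\{\mu_h,\mu_G\}}$ and, for all $k\ge0$, $\alpha_k\le\beta_k\le\lambda_k\le\frac14$, $$\beta_k\le\min\Big\{\tfrac1L,\ \tfrac{\mu_G}{320L^4}\lambda_k,\ \tfrac{\mu_h^3}{480(L+1)^6},\ \tfrac{\mu_G}{8L^2},\ \tfrac{\lambda_k}{4}\big(\tfrac{2L^2}{\mu_h^3}+58L^2\big)^{-1},\ \tfrac{\lambda_k}{4}\big(50L^2+\tfrac{8}{\mu_G}\big)^{-1}\Big\},$$ $$\alpha_k\le\min\Big\{\frac{\mu_G\beta_k}{4\left(14L^3+\frac{132(L+1)^6}{\mu_h^3}\right)},\ \frac{\mu_h^2}{3072(L+1)^6}\lambda_k\Big\}.$$ Let $x_k=h(\theta_k)-h^\star$. Then for all $k\ge0$ the iterates of the algorithm satisfy $$\mathbb{E}[x_{k+1}]\le\frac{B\tau^2}{k+\tau+1}+\frac{\tau^2}{(k+\tau+1)^2}\left(\|\Delta f_0\|^2+\|\Delta g_0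\|^2+x_0+y_0\right).$$
   Context: Setting. $h:\mathbb{R}^d\to\mathbb{R}$ is continuously differentiable (possibly non-convex) and attains its minimum; $h^\star=\min h$. $X$ denotes a random variable with values in a sample space $\mathcal{X}$ and distribution $\xi$. There are operators $F:\mathbb{R}^d\times\mathbb{R}^r\times\mathcal{X}\to\mathbb{R}^d$ and $G:\mathbb{R}^d\times\mathbb{R}^r\times\mathcal{X}\to\mathbb{R}^r$; write $F(\theta,\omega)=\mathbb{E}_{X\sim\xi}[F(\theta,\omega,X)]$ and $G(\theta,\omega)=\mathbb{E}_{X\sim\xi}[G(\theta,\omega,X)]$. For each $\theta$, $\omega^\star(\theta)\in\mathbb{R}^r$ is the unique solution of $G(\theta,\omega^\star(\theta))=0$, and $\nabla h(\theta)=F(\theta,\omega^\star(\theta))$. Standing assumptions. (Lipschitz continuity) There is a constant $L\ge1$ such that for all $\theta_1,\theta_2\in\mathbb{R}^d$, $\omega_1,\omega_2\in\mathbb{R}^r$, $X\in\mathcal{X}$: $\|F(\theta_1,\omega_1,X)-F(\theta_2,\omega_2,X)\|\le L(\|\theta_1-\theta_2\|+\|\omega_1-\omega_2\|)$, the same bound holds for $G$, $\|\nabla h(\theta_1)-\nabla h(\theta_2)\|\le L\|\theta_1-\theta_2\|$, and $\|\omega^\star(\theta_1)-\omega^\star(\theta_2)\|\le L\|\theta_1-\theta_2\|$. (Bounded variance) There is $B>0$ such that for all $\theta,\omega$: $\mathbb{E}_{X\sim\xi}[\|F(\theta,\omega,X)-F(\theta,\omega)\|^2]\le B$ and $\mathbb{E}_{X\sim\xi}[\|G(\theta,\omega,X)-G(\theta,\omega)\|^2]\le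 B$. (Strong monotonicity) There is $\mu_G>0$ such that $\langle G(\theta,\omega),\omega-\omega^\star(\theta)\rangle\ge\mu_G\|\omega-\omega^\star(\theta)\|^2$ for all $\theta,\omega$. Algorithm. Given deterministic $\theta_0,f_0\in\mathbb{R}^d$, $\omega_0,g_0\in\mathbb{R}^r$ and positive step sizes $\alpha_k,\beta_k,\lambda_k$, for $k=0,1,\dots$ draw $X_k\sim\xi$ independently (of the past) and set $\theta_{k+1}=\theta_k-\alpha_kf_k$, $\omega_{k+1}=\omega_k-\beta_kg_k$, $f_{k+1}=(1-\lambda_k)f_k+\lambda_kF(\theta_k,\omega_k,X_k)$, $g_{k+1}=(1-\lambda_k)g_k+\lambda_kG(\theta_k,\omega_k,X_k)$. Residuals. $\Delta f_k=f_k-F(\theta_k,\omega_k)$, $\Delta g_k=g_k-G(\theta_k,\omega_k)$, $y_k=\|\omega_k-\omega^\star(\theta_k)\|^2$. *)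

theory Defs
  imports "HOL-Probability.Probability"
begin

definition mean_op ::
    "'s measure \<Rightarrow> ('a \<Rightarrow> 'b \<Rightarrow> 's \<Rightarrow> 'c::{banach, second_countable_topology}) \<Rightarrow> 'a \<Rightarrow> 'b \<Rightarrow> 'c" where
  "mean_op \<xi> H \<theta> \<omega> = (LINT x|\<xi>. H \<theta> \<omega> x)"

text \<open>
  The second moment is a nonnegative extended integral: the real-valued Bochner integral of a
  non-integrable function is 0, so a bound on it would not force finite variance.
\<close>

definition bounded_variance ::
    "'s measure \<Rightarrow> ('a \<Rightarrow> 'b \<Rightarrow> 's \<Rightarrow> 'c::{banach, second_countable_topology}) \<Rightarrow> real \<Rightarrow> bool" where
  "bounded_variance \<xi> H B \<longleftrightarrow>
     (\<forall>\<theta> \<omega>. (\<integral>\<^sup>+x. ennreal ((norm (H \<theta> \<omega> x - mean_op \<xi> H \<theta> \<omega>))\<^sup>2) \<partial>\<xi>) \<le> ennreal B)"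

definition jointly_lipschitz ::
    "'s measure \<Rightarrow> ('a::real_normed_vector \<Rightarrow> 'b::real_normed_vector \<Rightarrow> 's \<Rightarrow> 'c::real_normed_vector)
       \<Rightarrow> real \<Rightarrow> bool" where
  "jointly_lipschitz \<xi> H L \<longleftrightarrow>
     (\<forall>x\<in>space \<xi>. \<forall>\<theta>1 \<theta>2 \<omega>1 \<omega>2.
        norm (H \<theta>1 \<omega>1 x - H \<theta>2 \<omega>2 x) \<le> L * (norm (\<theta>1 - \<theta>2) + norm (\<omega>1 - \<omega>2)))"

end

theory Submission imports Defs begin

text \<open>
  The Lyapunov function is the plain sum of \<open>\<parallel>\<Delta>f\<parallel>\<^sup>2\<close>, \<open>\<parallel>\<Delta>g\<parallel>\<^sup>2\<close>, \<open>x\<close> and \<open>y\<close>. Averaging contracts the two residuals by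
  \<open>1 - \<lambda>\<close> up to the drift of the mean operators, which is of order \<open>(\<alpha>\<^sup>2\<parallel>f\<parallel>\<^sup>2 + \<beta>\<^sup>2\<parallel>g\<parallel>\<^sup>2) / \<lambda>\<close>, and a variance
  \<open>\<lambda>\<^sup>2 B\<close> each. The descent inequality for \<open>h\<close> leaves a spare negative multiple of
  \<open>\<alpha>\<parallel>f\<parallel>\<^sup>2\<close>, which absorbs all drift caused by the motion of \<open>\<theta>\<close>, and strong monotonicity absorbs
  the terms in \<open>y\<close>. With \<open>n = k + \<tau> + 1\<close>, the conditional expectation of the Lyapunov function is thus
  at most \<open>1 - 2/n\<close> times its old value plus \<open>2 \<lambda>\<^sup>2 B \<le> \<tau>\<^sup>2 B / n\<^sup>2\<close>, and multiplying by
  \<open>n\<^sup>2\<close> makes the recursion telescope.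
\<close>

section \<open>Smoothness, joint measurability and averaging over the sample\<close>

text \<open>Along the segment, \<open>h\<close> minus the claimed quadratic upper model has a
  nonpositive derivative, by Cauchy-Schwarz and the Lipschitz gradient. Monotonicity of this
  one-variable function replaces integration of the gradient.\<close>

lemma smooth_descent:
  fixes h :: "'a::real_inner \<Rightarrow> real"
  assumes grad: "\<And>t. GDERIV h t :> gh t"
    and lip: "\<And>s t. norm (gh s - gh t) \<le> L * norm (s - t)"
  shows "h (t + d) \<le> h t + gh t \<bullet> d + L / 2 * (norm d)\<^sup>2"
proof -
  define \<phi> where "\<phi> s = h (t + s *\<^sub>R d) - s * (gh t \<bullet> d) - L / 2 * s\<^sup>2 * (norm d)\<^sup>2" for s
  have der: "(\<phi> has_real_derivative (gh (t + s *\<^sub>R d) \<bullet> d - gh t \<bullet> d - L * s * (norm d)\<^sup>2)) (at s)" for s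
  proof -
    have "(h has_derivative (\<lambda>v. v \<bullet> gh (t + s *\<^sub>R d))) (at (t + s *\<^sub>R d))"
      using grad[of "t + s *\<^sub>R d"] by (simp add: gderiv_def)
    moreover have "((\<lambda>s. t + s *\<^sub>R d) has_derivative (\<lambda>v. v *\<^sub>R d)) (at s)"
      by (auto intro!: derivative_eq_intros)
    ultimately have "((\<lambda>s. h (t + s *\<^sub>R d)) has_derivative (\<lambda>v. (v *\<^sub>R d) \<bullet> gh (t + s *\<^sub>R d))) (at s)"
      by (rule has_derivative_compose[rotated])
    then have "((\<lambda>s. h (t + s *\<^sub>R d)) has_real_derivative (gh (t + s *\<^sub>R d) \<bullet> d)) (at s)"
      by (simp add: has_field_derivative_def inner_commute mult_commute_abs)
    then show ?thesis
      unfolding \<phi>_def by (auto intro!: derivative_eq_intros)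
  qed
  have "gh (t + s *\<^sub>R d) \<bullet> d - gh t \<bullet> d - L * s * (norm d)\<^sup>2 \<le> 0" if "0 \<le> s" for s
  proof -
    have "gh (t + s *\<^sub>R d) \<bullet> d - gh t \<bullet> d \<le> norm (gh (t + s *\<^sub>R d) - gh t) * norm d"
      using norm_cauchy_schwarz[of "gh (t + s *\<^sub>R d) - gh t" d] by (simp add: inner_diff_left)
    also have "\<dots> \<le> (L * norm (s *\<^sub>R d)) * norm d"
      using lip[of "t + s *\<^sub>R d" t] by (intro mult_right_mono) auto
    finally show ?thesis using that by (simp add: power2_eq_square)
  qed
  then have "\<phi> 1 \<le> \<phi> 0"
    using der by (intro DERIV_nonpos_imp_nonincreasing[of 0 1 \<phi>] zero_le_one) blast
  then show ?thesis by (simp add: \<phi>_def)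
qed

text \<open>Replacing the argument \<open>a\<close> by a simple-function approximation leaves
  finitely many measurable sections of \<open>H\<close>; continuity in \<open>a\<close> then
  recovers \<open>H\<close> as a pointwise limit of jointly measurable maps.\<close>

lemma measurable_Caratheodory:
  fixes H :: "'a::{metric_space, second_countable_topology} \<Rightarrow> 's \<Rightarrow> 'c::metric_space"
  assumes meas: "\<And>a. H a \<in> borel_measurable N"
    and cont: "\<And>x. x \<in> space N \<Longrightarrow> continuous_on UNIV (\<lambda>a. H a x)"
  shows "(\<lambda>(a, x). H a x) \<in> borel_measurable (borel \<Otimes>\<^sub>M N)"
proof -
  \<comment> \<open>The approximation theorem is applied to the identity map;
    \<open>undefined\<close> is only an arbitrary reference point of the metric space.\<close>
  have "\<exists>S :: nat \<Rightarrow> 'a \<Rightarrow> 'a. (\<forall>i. simple_function borel (S i)) \<and> (\<forall>a\<in>space borel. (\<lambda>i. S i a) \<longlonglongrightarrow> a) \<and>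
      (\<forall>i. \<forall>a\<in>space borel. dist (S i a) undefined \<le> 2 * dist a undefined)"
    by (rule borel_measurable_implies_sequence_metric) simp
  then obtain S :: "nat \<Rightarrow> 'a \<Rightarrow> 'a" where S: "\<forall>i. simple_function borel (S i)"
      "\<forall>a\<in>space borel. (\<lambda>i. S i a) \<longlonglongrightarrow> a"
    by blast
  have simple: "simple_function borel (S i)" for i using S(1) by blast
  have lim: "(\<lambda>i. S i a) \<longlonglongrightarrow> a" for a using S(2) by simp
  show ?thesis
  proof (rule borel_measurable_LIMSEQ_metric)
    fix i
    have fin: "finite (range (S i))" using simple[of i] by (simp add: simple_function_def)
    \<comment> \<open>Because its range is finite, \<open>S i\<close> is measurable into a discrete
      space, so \<open>H\<close> may be treated separately for each value of
      \<open>S i\<close>.\<close>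
    have cs: "S i \<in> borel \<rightarrow>\<^sub>M count_space (range (S i))"
      unfolding measurable_count_space_eq2[OF fin] using simple_functionD(2)[OF simple[of i]] by simp
    have "(\<lambda>p. S i (fst p)) \<in> borel \<Otimes>\<^sub>M N \<rightarrow>\<^sub>M count_space (range (S i))"
      by (rule measurable_compose[OF measurable_fst cs])
    then show "(\<lambda>p. H (S i (fst p)) (snd p)) \<in> borel_measurable (borel \<Otimes>\<^sub>M N)"
      by (rule measurable_compose_countable'[where f="\<lambda>a p. H a (snd p)", OF _ _ countable_finite[OF fin], rotated])
        (rule measurable_compose[OF measurable_snd meas])
  next
    fix p :: "'a \<times> 's" assume "p \<in> space (borel \<Otimes>\<^sub>M N)"
    then have "isCont (\<lambda>a. H a (snd p)) (fst p)"
      using cont[of "snd p"] by (auto simp: space_pair_measure continuous_on_eq_continuous_at)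
    then show "(\<lambda>i. H (S i (fst p)) (snd p)) \<longlonglongrightarrow> (case p of (a, x) \<Rightarrow> H a x)"
      using isCont_tendsto_compose[OF _ lim[of "fst p"]] by (simp add: case_prod_beta)
  qed
qed

lemma mean_op_lipschitz:
  assumes "prob_space \<xi>" and int: "\<And>t w. integrable \<xi> (H t w)" and lip: "jointly_lipschitz \<xi> H L"
  shows "norm (mean_op \<xi> H t1 w1 - mean_op \<xi> H t2 w2) \<le> L * (norm (t1 - t2) + norm (w1 - w2))"
proof -
  interpret prob_space \<xi> by fact
  have "mean_op \<xi> H t1 w1 - mean_op \<xi> H t2 w2 = (LINT x|\<xi>. H t1 w1 x - H t2 w2 x)"
    unfolding mean_op_def using int by simp
  also have "norm \<dots> \<le> (LINT x|\<xi>. norm (H t1 w1 x - H t2 w2 x))"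
    by (rule integral_norm_bound)
  also have "\<dots> \<le> (LINT x|\<xi>. L * (norm (t1 - t2) + norm (w1 - w2)))"
    using lip int by (intro integral_mono_AE) (auto simp: jointly_lipschitz_def)
  finally show ?thesis by (simp add: prob_space)
qed

text \<open>The noise is centred, so its cross term with the deterministic \<open>u\<close>
  integrates to zero and only the variance is added.\<close>

lemma nn_integral_shifted_noise:
  fixes H :: "'a \<Rightarrow> 'b \<Rightarrow> 's \<Rightarrow> 'c::euclidean_space"
  assumes "prob_space \<xi>" and int: "integrable \<xi> (H t w)" and var: "bounded_variance \<xi> H B" and "0 \<le> B"
  shows "(\<integral>\<^sup>+x. ennreal ((norm (u + c *\<^sub>R (H t w x - mean_op \<xi> H t w)))\<^sup>2) \<partial>\<xi>)
    \<le> ennreal ((norm u)\<^sup>2 + c\<^sup>2 * B)"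
proof -
  interpret prob_space \<xi> by fact
  define n where "n x = H t w x - mean_op \<xi> H t w" for x
  have n_int: "integrable \<xi> n" and n_mean: "integral\<^sup>L \<xi> n = 0"
    using int by (auto simp: n_def[abs_def] mean_op_def prob_space)
  have n_nn: "(\<integral>\<^sup>+x. ennreal ((norm (n x))\<^sup>2) \<partial>\<xi>) \<le> ennreal B"
    using var by (auto simp: bounded_variance_def n_def)
  have meas: "n \<in> borel_measurable \<xi>" using n_int by auto
  \<comment> \<open>Finiteness of the extended integral gives square integrability, which justifies
    integrating the expanded square term by term.\<close>
  have n2_int: "integrable \<xi> (\<lambda>x. (norm (n x))\<^sup>2)"
    using n_nn meas by (intro integrableI_bounded) (auto simp: less_top[symmetric] top_unique)
  have "(LINT x|\<xi>. (norm (n x))\<^sup>2) \<le> B"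
    using n_nn n2_int \<open>0 \<le> B\<close> by (simp add: nn_integral_eq_integral)
  then have B': "c\<^sup>2 * (LINT x|\<xi>. (norm (n x))\<^sup>2) \<le> c\<^sup>2 * B" by (intro mult_left_mono) auto
  have eq: "(norm (u + c *\<^sub>R n x))\<^sup>2 = (norm u)\<^sup>2 + 2 * c * (u \<bullet> n x) + c\<^sup>2 * (norm (n x))\<^sup>2" for x
    unfolding power2_norm_eq_inner by (simp add: inner_simps power2_eq_square inner_commute)
  have int': "integrable \<xi> (\<lambda>x. (norm (u + c *\<^sub>R n x))\<^sup>2)"
    unfolding eq using n_int n2_int by auto
  have "(LINT x|\<xi>. (norm (u + c *\<^sub>R n x))\<^sup>2) = (norm u)\<^sup>2 + c\<^sup>2 * (LINT x|\<xi>. (norm (n x))\<^sup>2)"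
    unfolding eq using n_int n2_int by (simp add: n_mean prob_space)
  then show ?thesis
    using B' by (simp add: n_def[symmetric] nn_integral_eq_integral[OF int'] ennreal_leI del: ennreal_plus)
qed

section \<open>Conditioning on the past of an i.i.d. driven recursion\<close>

text \<open>\<open>Z k\<close> is a function of the samples before \<open>k\<close>, hence
  independent of \<open>X k\<close>. The joint law of \<open>Z k\<close> and \<open>X k\<close> is
  therefore a product, and Tonelli turns the next expectation into an iterated integral. This takes
  the place of conditional expectations.\<close>

lemma measurable_iid_recursion:
  assumes "prob_space M" and indep: "prob_space.indep_vars M (\<lambda>_. \<xi>) X (UNIV :: nat set)"
    and distr: "\<And>k. distr M \<xi> (X k) = \<xi>"
    and T: "\<And>k. (\<lambda>(z, x). T k z x) \<in> N \<Otimes>\<^sub>M \<xi> \<rightarrow>\<^sub>M N"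
    and z0: "z0 \<in> space N" and Z0: "\<And>s. s \<in> space M \<Longrightarrow> Z 0 s = z0"
    and ZSuc: "\<And>k s. s \<in> space M \<Longrightarrow> Z (Suc k) s = T k (Z k s) (X k s)"
  shows "Z k \<in> M \<rightarrow>\<^sub>M N"
    and "V \<in> borel_measurable N \<Longrightarrow>
      (\<integral>\<^sup>+s. V (Z (Suc k) s) \<partial>M) = (\<integral>\<^sup>+s. (\<integral>\<^sup>+x. V (T k (Z k s) x) \<partial>\<xi>) \<partial>M)"
proof -
  interpret prob_space M by fact
  have X: "X k \<in> M \<rightarrow>\<^sub>M \<xi>" for k using indep by (auto simp: indep_vars_def)
  have prob\<xi>: "prob_space \<xi>" using prob_space_distr[OF X[of 0]] distr[of 0] by simp
  \<comment> \<open>The recursion as a deterministic function of a whole sample sequence;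
    \<open>P k\<close> reads only the coordinates below \<open>k\<close>.\<close>
  define P where "P k x = rec_nat z0 (\<lambda>i z. T i z (x i)) k" for k and x :: "nat \<Rightarrow> 'b"
  have P_cong: "P k x = P k y" if "\<And>i. i < k \<Longrightarrow> x i = y i" for k x y
    using that by (induction k) (auto simp: P_def)
  have P_meas: "P k \<in> PiM {..<k} (\<lambda>_. \<xi>) \<rightarrow>\<^sub>M N" for k
  proof (induction k)
    case 0 then show ?case using z0 by (simp add: P_def)
  next
    case (Suc k)
    have "(\<lambda>x. P k (restrict x {..<k})) \<in> PiM {..<Suc k} (\<lambda>_. \<xi>) \<rightarrow>\<^sub>M N"
      by (rule measurable_compose[OF measurable_restrict_subset Suc]) auto
    moreover have "(\<lambda>x. P k (restrict x {..<k})) = P k" by (intro ext P_cong) auto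
    ultimately have "(\<lambda>x. (P k x, x k)) \<in> PiM {..<Suc k} (\<lambda>_. \<xi>) \<rightarrow>\<^sub>M N \<Otimes>\<^sub>M \<xi>"
      by (intro measurable_Pair measurable_component_singleton) auto
    from measurable_compose[OF this T[of k]] show ?case by (simp add: P_def)
  qed
  define past where "past k = (\<lambda>s. restrict (\<lambda>i. X i s) {..<k})" for k
  \<comment> \<open>The current sample is kept as a family over the singleton \<open>{k}\<close>, so
    that independence of restrictions to disjoint index sets applies to it and
    \<open>past k\<close>.\<close>
  define now where "now k = (\<lambda>s. restrict (\<lambda>i. X i s) {k})" for k
  have Z_eq: "Z k s = P k (past k s)" if s: "s \<in> space M" for k s
  proof -
    have "Z k s = P k (\<lambda>i. X i s)" by (induction k) (auto simp: P_def Z0 ZSuc s)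
    also have "\<dots> = P k (past k s)" unfolding past_def by (rule P_cong) auto
    finally show ?thesis .
  qed
  have Z_meas: "Z k \<in> M \<rightarrow>\<^sub>M N" for k
  proof -
    have "(\<lambda>s. P k (past k s)) \<in> M \<rightarrow>\<^sub>M N"
      unfolding past_def using X by (intro measurable_compose[OF measurable_restrict P_meas]) auto
    then show ?thesis by (subst measurable_cong[OF Z_eq])
  qed
  then show "Z k \<in> M \<rightarrow>\<^sub>M N" .
  assume V: "V \<in> borel_measurable N"
  have "indep_var (PiM {..<k} (\<lambda>_. \<xi>)) (past k) (PiM {k} (\<lambda>_. \<xi>)) (now k)"
    unfolding past_def now_def using indep by (rule indep_var_restrict) auto
  then have joint: "distr M (PiM {..<k} (\<lambda>_. \<xi>)) (past k) \<Otimes>\<^sub>M distr M (PiM {k} (\<lambda>_. \<xi>)) (now k)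
      = distr M (PiM {..<k} (\<lambda>_. \<xi>) \<Otimes>\<^sub>M PiM {k} (\<lambda>_. \<xi>)) (\<lambda>s. (past k s, now k s))"
    by (simp add: indep_var_distribution_eq)
  have past: "past k \<in> M \<rightarrow>\<^sub>M PiM {..<k} (\<lambda>_. \<xi>)" and now: "now k \<in> M \<rightarrow>\<^sub>M PiM {k} (\<lambda>_. \<xi>)"
    using X by (auto simp: past_def now_def intro!: measurable_restrict)
  have eval: "(\<lambda>x. x k) \<in> PiM {k} (\<lambda>_. \<xi>) \<rightarrow>\<^sub>M \<xi>" by (rule measurable_component_singleton) auto
  have P: "distr (distr M (PiM {..<k} (\<lambda>_. \<xi>)) (past k)) N (P k) = distr M N (Z k)"
    using past P_meas by (subst distr_distr) (auto simp: Z_eq intro!: distr_cong)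
  have "distr (distr M (PiM {k} (\<lambda>_. \<xi>)) (now k)) \<xi> (\<lambda>x. x k) = distr M \<xi> (X k)"
    using now eval by (subst distr_distr) (auto simp: now_def intro!: distr_cong)
  then have now_eq: "distr (distr M (PiM {k} (\<lambda>_. \<xi>)) (now k)) \<xi> (\<lambda>x. x k) = \<xi>"
    by (simp add: distr)
  \<comment> \<open>Pushing the product law of \<open>past k\<close> and \<open>now k\<close>
    through \<open>P k\<close> and evaluation at \<open>k\<close> gives the product of the law of
    \<open>Z k\<close> with \<open>\<xi>\<close>.\<close>
  have "distr M N (Z k) \<Otimes>\<^sub>M \<xi>
      = distr (distr M (PiM {..<k} (\<lambda>_. \<xi>)) (past k) \<Otimes>\<^sub>M distr M (PiM {k} (\<lambda>_. \<xi>)) (now k))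
          (N \<Otimes>\<^sub>M \<xi>) (\<lambda>(x, y). (P k x, y k))"
    using pair_measure_distr[of "P k" "distr M (PiM {..<k} (\<lambda>_. \<xi>)) (past k)" N "\<lambda>x. x k"
        "distr M (PiM {k} (\<lambda>_. \<xi>)) (now k)" \<xi>] P_meas[of k] eval prob\<xi>
    by (simp add: P now_eq prob_space_imp_sigma_finite)
  also have "\<dots> = distr M (N \<Otimes>\<^sub>M \<xi>) (\<lambda>s. (Z k s, X k s))"
    unfolding joint using past now P_meas[of k] eval
    by (subst distr_distr) (auto simp: Z_eq now_def intro!: distr_cong)
  finally have joint: "distr M (N \<Otimes>\<^sub>M \<xi>) (\<lambda>s. (Z k s, X k s)) = distr M N (Z k) \<Otimes>\<^sub>M \<xi>" ..
  interpret \<xi>: prob_space \<xi> by fact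
  have VT: "(\<lambda>p. V (case p of (z, x) \<Rightarrow> T k z x)) \<in> borel_measurable (N \<Otimes>\<^sub>M \<xi>)"
    by (rule measurable_compose[OF T V])
  have "(\<integral>\<^sup>+s. V (Z (Suc k) s) \<partial>M) = (\<integral>\<^sup>+s. (\<lambda>p. V (case p of (z, x) \<Rightarrow> T k z x)) (Z k s, X k s) \<partial>M)"
    by (intro nn_integral_cong) (simp add: ZSuc)
  also have "\<dots> = (\<integral>\<^sup>+p. V (case p of (z, x) \<Rightarrow> T k z x) \<partial>(distr M (N \<Otimes>\<^sub>M \<xi>) (\<lambda>s. (Z k s, X k s))))"
    using Z_meas X VT by (subst nn_integral_distr) auto
  also have "\<dots> = (\<integral>\<^sup>+z. (\<integral>\<^sup>+x. V (T k z x) \<partial>\<xi>) \<partial>(distr M N (Z k)))"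
    unfolding joint using VT by (subst \<xi>.nn_integral_fst[symmetric]) auto
  also have "\<dots> = (\<integral>\<^sup>+s. (\<integral>\<^sup>+x. V (T k (Z k s) x) \<partial>\<xi>) \<partial>M)"
    using Z_meas \<xi>.borel_measurable_nn_integral_fst[OF VT] by (subst nn_integral_distr) auto
  finally show "(\<integral>\<^sup>+s. V (Z (Suc k) s) \<partial>M) = (\<integral>\<^sup>+s. (\<integral>\<^sup>+x. V (T k (Z k s) x) \<partial>\<xi>) \<partial>M)" .
qed

section \<open>One-step inequalities for residuals, objective and tracking error\<close>

lemma norm_add_le_twice:
  fixes u v :: "'a::real_inner"
  shows "(norm (u + v))\<^sup>2 \<le> 2 * (norm u)\<^sup>2 + 2 * (norm v)\<^sup>2"
proof -
  have "2 * (norm u)\<^sup>2 + 2 * (norm v)\<^sup>2 - (norm (u + v))\<^sup>2 = (norm (u - v))\<^sup>2"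
    unfolding power2_norm_eq_inner by (simp add: inner_simps inner_commute)
  then show ?thesis by (metis diff_ge_0_iff_ge zero_le_power2)
qed

text \<open>Young's inequality: after multiplication by \<open>\<eta>\<close> the gap is a perfect
  square.\<close>

lemma norm_add_le_weighted:
  fixes u v :: "'a::real_inner"
  assumes "0 < \<eta>"
  shows "(norm (v + u))\<^sup>2 \<le> (1 + \<eta>) * (norm v)\<^sup>2 + (1 + 1 / \<eta>) * (norm u)\<^sup>2"
proof -
  have "\<eta> * ((1 + \<eta>) * (norm v)\<^sup>2 + (1 + 1 / \<eta>) * (norm u)\<^sup>2 - (norm (v + u))\<^sup>2) = (norm (\<eta> *\<^sub>R v - u))\<^sup>2"
    using assms unfolding power2_norm_eq_inner
    by (simp add: inner_simps inner_commute field_simps)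
  then show ?thesis
    using assms by (metis diff_ge_0_iff_ge zero_le_mult_iff zero_le_power2 linorder_not_less order_less_asym)
qed

text \<open>Convexity of the squared norm at the points \<open>e\<close> and \<open>D / l\<close>
  with weights \<open>1 - l\<close> and \<open>l\<close>. The contraction factor stays exactly
  \<open>1 - l\<close>, and the perturbation pays \<open>1 / l\<close>.\<close>

lemma norm_relaxed_add_le:
  fixes e D :: "'a::real_inner"
  assumes "0 < l" "l \<le> 1"
  shows "(norm ((1 - l) *\<^sub>R e + D))\<^sup>2 \<le> (1 - l) * (norm e)\<^sup>2 + (norm D)\<^sup>2 / l"
proof -
  have "l * ((1 - l) * (norm e)\<^sup>2 + (norm D)\<^sup>2 / l - (norm ((1 - l) *\<^sub>R e + D))\<^sup>2)
      = (1 - l) * (norm (l *\<^sub>R e - D))\<^sup>2"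
    using assms unfolding power2_norm_eq_inner
    by (simp add: inner_simps inner_commute field_simps)
  moreover have "0 \<le> (1 - l) * (norm (l *\<^sub>R e - D))\<^sup>2" using assms by simp
  ultimately show ?thesis
    using assms by (metis diff_ge_0_iff_ge zero_le_mult_iff linorder_not_less order_less_asym)
qed

text \<open>The new residual splits into the old one times \<open>1 - l\<close>, the drift
  \<open>D\<close> of the mean operator between the two parameter pairs, and \<open>l\<close> times
  centred noise. The first two are deterministic, so the noise adds only its variance.\<close>

lemma tracking_error_step:
  fixes H :: "'a::real_normed_vector \<Rightarrow> 'b::real_normed_vector \<Rightarrow> 's \<Rightarrow> 'c::euclidean_space"
  assumes prob: "prob_space \<xi>" and int: "\<And>t w. integrable \<xi> (H t w)"
    and lip: "jointly_lipschitz \<xi> H L" and "0 \<le> L"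
    and var: "bounded_variance \<xi> H B" and "0 \<le> B"
    and l: "0 < l" "l \<le> 1"
  shows "(\<integral>\<^sup>+x. ennreal ((norm ((1 - l) *\<^sub>R e + l *\<^sub>R H t w x - mean_op \<xi> H t' w'))\<^sup>2) \<partial>\<xi>)
    \<le> ennreal ((1 - l) * (norm (e - mean_op \<xi> H t w))\<^sup>2
        + 2 * L\<^sup>2 * ((norm (t - t'))\<^sup>2 + (norm (w - w'))\<^sup>2) / l + l\<^sup>2 * B)"
proof -
  let ?m = "mean_op \<xi> H"
  define D where "D = ?m t w - ?m t' w'"
  define u where "u = (1 - l) *\<^sub>R (e - ?m t w) + D"
  have "(\<integral>\<^sup>+x. ennreal ((norm ((1 - l) *\<^sub>R e + l *\<^sub>R H t w x - ?m t' w'))\<^sup>2) \<partial>\<xi>)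
      = (\<integral>\<^sup>+x. ennreal ((norm (u + l *\<^sub>R (H t w x - ?m t w)))\<^sup>2) \<partial>\<xi>)"
    by (simp add: u_def D_def algebra_simps)
  also have "\<dots> \<le> ennreal ((norm u)\<^sup>2 + l\<^sup>2 * B)"
    using prob int var \<open>0 \<le> B\<close> by (rule nn_integral_shifted_noise)
  also have "\<dots> \<le> ennreal ((1 - l) * (norm (e - ?m t w))\<^sup>2
        + 2 * L\<^sup>2 * ((norm (t - t'))\<^sup>2 + (norm (w - w'))\<^sup>2) / l + l\<^sup>2 * B)"
  proof (rule ennreal_leI, rule add_right_mono)
    have "norm D \<le> L * (norm (t - t') + norm (w - w'))"
      unfolding D_def by (rule mean_op_lipschitz[OF prob int lip])
    then have "(norm D)\<^sup>2 \<le> (L * (norm (t - t') + norm (w - w')))\<^sup>2"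
      by (intro power_mono) auto
    also have "\<dots> \<le> L\<^sup>2 * (2 * ((norm (t - t'))\<^sup>2 + (norm (w - w'))\<^sup>2))"
      unfolding power_mult_distrib
      using sum_squares_bound[of "norm (t - t')" "norm (w - w')"]
      by (intro mult_left_mono) (auto simp: power2_sum)
    finally have "(norm D)\<^sup>2 / l \<le> 2 * L\<^sup>2 * ((norm (t - t'))\<^sup>2 + (norm (w - w'))\<^sup>2) / l"
      using l by (intro divide_right_mono) (auto simp: algebra_simps)
    then show "(norm u)\<^sup>2 \<le> (1 - l) * (norm (e - ?m t w))\<^sup>2
        + 2 * L\<^sup>2 * ((norm (t - t'))\<^sup>2 + (norm (w - w'))\<^sup>2) / l"
      unfolding u_def using norm_relaxed_add_le[OF l, of "e - ?m t w" D] by linarith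
  qed
  finally show ?thesis .
qed

text \<open>Polarizing the inner product of gradient and \<open>f\<close> is an identity, so it
  retains a negative multiple of the squared norm of \<open>f\<close>; the squared gradient is
  traded for the excess through the PL inequality.\<close>

lemma PL_descent_step:
  fixes h :: "'a::real_inner \<Rightarrow> real"
  assumes grad: "\<And>t. GDERIV h t :> gh t"
    and lip: "\<And>s t. norm (gh s - gh t) \<le> L * norm (s - t)"
    and PL: "\<mu> * (h t - hstar) \<le> 1/2 * (norm (gh t))\<^sup>2"
    and "0 \<le> a"
  shows "h (t - a *\<^sub>R f) - hstar
    \<le> (1 - a * \<mu>) * (h t - hstar) - a / 2 * (1 - L * a) * (norm f)\<^sup>2 + a / 2 * (norm (f - gh t))\<^sup>2"
proof -
  have "h (t - a *\<^sub>R f) \<le> h t - a * (gh t \<bullet> f) + L / 2 * (a\<^sup>2 * (norm f)\<^sup>2)"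
    using smooth_descent[OF grad lip, of t "- (a *\<^sub>R f)"] by (simp add: power_mult_distrib)
  moreover have "a * (gh t \<bullet> f) = a * ((norm (gh t))\<^sup>2 / 2 + (norm f)\<^sup>2 / 2 - (norm (f - gh t))\<^sup>2 / 2)"
    unfolding power2_norm_eq_inner by (simp add: inner_simps inner_commute diff_divide_distrib add_divide_distrib)
  moreover have "a * (\<mu> * (h t - hstar)) \<le> a * (1/2 * (norm (gh t))\<^sup>2)"
    using PL \<open>0 \<le> a\<close> by (rule mult_left_mono)
  ultimately show ?thesis by (simp add: algebra_simps power2_eq_square diff_divide_distrib)
qed

text \<open>Here \<open>z\<close> is the distance vector from \<open>w\<close> to its root,
  \<open>m\<close> the mean operator, \<open>g\<close> its estimate, and \<open>u\<close> the
  displacement of the root when \<open>t\<close> moves by \<open>a\<close> times a vector of norm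
  \<open>p\<close>.\<close>

lemma strongly_monotone_step:
  fixes z g m u :: "'a::real_inner"
  assumes mono: "\<mu> * (norm z)\<^sup>2 \<le> m \<bullet> z" and bound: "norm m \<le> L * norm z"
    and u: "norm u \<le> L * (a * p)"
    and pos: "0 < \<mu>" "\<mu> \<le> L" "1 \<le> L" "0 < b" "0 \<le> a"
    and b: "8 * L\<^sup>2 * b \<le> \<mu>" and a: "56 * L\<^sup>2 * a \<le> \<mu> * b"
  shows "(norm (z - b *\<^sub>R g + u))\<^sup>2
    \<le> (1 - b * \<mu>) * (norm z)\<^sup>2 + 17/16 * (4 * b / \<mu> + 2 * b\<^sup>2) * (norm (g - m))\<^sup>2 + a / 25 * p\<^sup>2"
proof -
  define q where "q = norm (g - m)"
  \<comment> \<open>The step without \<open>u\<close> contracts by \<open>1 - 3 * \<eta>\<close>,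
    adding \<open>u\<close> costs a factor \<open>1 + \<eta>\<close>, and the product is at most
    \<open>1 - 2 * \<eta> = 1 - b * \<mu>\<close>.\<close>
  define \<eta> where "\<eta> = b * \<mu> / 2"
  have "\<mu> * \<mu> \<le> L * L" using pos by (intro mult_mono) auto
  then have "8 * b * (\<mu> * \<mu>) \<le> 8 * b * (L * L)" using pos by (intro mult_left_mono) auto
  also have "\<dots> \<le> \<mu>" using b by (simp add: power2_eq_square mult_ac)
  finally have "8 * (b * \<mu>) * \<mu> \<le> 1 * \<mu>" by (simp add: mult_ac)
  then have bmu: "b * \<mu> \<le> 1/8" using pos by (simp only: mult_le_cancel_right_pos)
  then have \<eta>: "0 < \<eta>" "\<eta> \<le> 1/16" using pos by (auto simp: \<eta>_def field_simps)
  have v: "(norm (z - b *\<^sub>R g))\<^sup>2 \<le> (1 - 3 * \<eta>) * (norm z)\<^sup>2 + (4 * b / \<mu> + 2 * b\<^sup>2) * q\<^sup>2"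
  proof -
    have eq: "(norm (z - b *\<^sub>R g))\<^sup>2 = (norm z)\<^sup>2 - 2 * b * (m \<bullet> z) - 2 * b * ((g - m) \<bullet> z) + b\<^sup>2 * (norm g)\<^sup>2"
      unfolding power2_norm_eq_inner by (simp add: inner_simps inner_commute power2_eq_square algebra_simps)
    have 1: "b * (\<mu> * (norm z)\<^sup>2) \<le> b * (m \<bullet> z)" using mono pos by (intro mult_left_mono) auto
    have "- ((g - m) \<bullet> z) \<le> q * norm z"
      unfolding q_def using Cauchy_Schwarz_ineq2[of "g - m" z] by linarith
    \<comment> \<open>The weights are chosen so that, after the factor \<open>2 * b\<close>, a
      quarter of \<open>b * \<mu>\<close> is spent here. The term in the squared norm of
      \<open>g\<close> spends another quarter, which leaves \<open>3/2\<close> of the available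
      \<open>2\<close>.\<close>
    also have "\<dots> \<le> \<mu> / 8 * (norm z)\<^sup>2 + 2 / \<mu> * q\<^sup>2"
    proof -
      have "0 \<le> (\<mu> * norm z - 4 * q)\<^sup>2 / (8 * \<mu>)" using pos by simp
      also have "\<dots> = \<mu> / 8 * (norm z)\<^sup>2 + 2 / \<mu> * q\<^sup>2 - q * norm z"
        using pos by (simp add: power2_eq_square field_simps)
      finally show ?thesis by simp
    qed
    finally have 2: "b * (- ((g - m) \<bullet> z)) \<le> b * (\<mu> / 8 * (norm z)\<^sup>2 + 2 / \<mu> * q\<^sup>2)"
      using pos by (intro mult_left_mono) auto
    have "(norm g)\<^sup>2 \<le> 2 * q\<^sup>2 + 2 * (norm m)\<^sup>2"
      using norm_add_le_twice[of "g - m" m] by (simp add: q_def)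
    also have "(norm m)\<^sup>2 \<le> (L * norm z)\<^sup>2" using bound by (intro power_mono) auto
    finally have "b\<^sup>2 * (norm g)\<^sup>2 \<le> b\<^sup>2 * (2 * q\<^sup>2 + 2 * (L * norm z)\<^sup>2)"
      by (intro mult_left_mono) auto
    moreover have "b * (8 * L\<^sup>2 * b) * (norm z)\<^sup>2 \<le> b * \<mu> * (norm z)\<^sup>2"
      using b pos by (intro mult_right_mono mult_left_mono) auto
    ultimately have 3: "b\<^sup>2 * (norm g)\<^sup>2 \<le> 2 * b\<^sup>2 * q\<^sup>2 + b * \<mu> * (norm z)\<^sup>2 / 4"
      by (simp add: power2_eq_square algebra_simps)
    show ?thesis unfolding eq using 1 2 3 by (simp add: \<eta>_def algebra_simps)
  qed
  have "(norm (z - b *\<^sub>R g + u))\<^sup>2 \<le> (1 + \<eta>) * (norm (z - b *\<^sub>R g))\<^sup>2 + (1 + 1 / \<eta>) * (norm u)\<^sup>2"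
    using \<eta>(1) by (rule norm_add_le_weighted)
  also have "(1 + \<eta>) * (norm (z - b *\<^sub>R g))\<^sup>2
      \<le> (1 + \<eta>) * ((1 - 3 * \<eta>) * (norm z)\<^sup>2 + (4 * b / \<mu> + 2 * b\<^sup>2) * q\<^sup>2)"
    using v \<eta> by (intro mult_left_mono) auto
  also have "\<dots> \<le> (1 - b * \<mu>) * (norm z)\<^sup>2 + 17/16 * (4 * b / \<mu> + 2 * b\<^sup>2) * q\<^sup>2"
  proof -
    have "(1 + \<eta>) * (1 - 3 * \<eta>) = 1 - b * \<mu> - 3 * \<eta>\<^sup>2" 
      by (simp add: \<eta>_def power2_eq_square algebra_simps)
    then have "(1 + \<eta>) * (1 - 3 * \<eta>) * (norm z)\<^sup>2 \<le> (1 - b * \<mu>) * (norm z)\<^sup>2"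
      by (intro mult_right_mono) auto
    moreover have "(1 + \<eta>) * ((4 * b / \<mu> + 2 * b\<^sup>2) * q\<^sup>2) \<le> 17/16 * ((4 * b / \<mu> + 2 * b\<^sup>2) * q\<^sup>2)"
      using \<eta> pos by (intro mult_right_mono) auto
    ultimately show ?thesis by (simp only: distrib_left[of "1 + \<eta>"] mult.assoc add_mono)
  qed
  also have "(1 + 1 / \<eta>) * (norm u)\<^sup>2 \<le> a / 25 * p\<^sup>2"
  proof -
    have "(norm u)\<^sup>2 \<le> (L * (a * p))\<^sup>2" using u by (intro power_mono) auto
    \<comment> \<open>Since \<open>b * \<mu> \<le> 1/8\<close>, the summand \<open>1\<close> is at
      most \<open>1/8 / (b * \<mu>)\<close>. With the bound on \<open>a\<close> the constant becomes
      \<open>17/448\<close>, just below \<open>1/25\<close>.\<close>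
    moreover have "1 + 1 / \<eta> \<le> 17/8 / (b * \<mu>)" using \<eta> pos bmu by (simp add: \<eta>_def field_simps)
    ultimately have "(1 + 1 / \<eta>) * (norm u)\<^sup>2 \<le> 17/8 / (b * \<mu>) * (L * (a * p))\<^sup>2"
      using pos by (intro mult_mono) auto
    also have "\<dots> = 17/8 / (b * \<mu>) * (L\<^sup>2 * a) * (a * p\<^sup>2)" by (simp add: power2_eq_square)
    also have "\<dots> \<le> 17/8 / (b * \<mu>) * (b * \<mu> / 56) * (a * p\<^sup>2)"
      using a pos by (intro mult_right_mono mult_left_mono) (auto simp: mult_ac)
    also have "\<dots> \<le> 1/25 * (a * p\<^sup>2)" using pos by (intro mult_right_mono) auto
    finally show ?thesis by simp
  qed
  finally show ?thesis by (simp add: q_def)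
qed

section \<open>Scalar arithmetic: contraction coefficients and the harmonic recursion\<close>

text \<open>\<open>P\<close>, \<open>Q\<close>, \<open>x\<close>, \<open>y\<close> are the four
  summands of the Lyapunov function before the step, \<open>p\<close> and \<open>q\<close> the
  squared norms of \<open>f\<close> and \<open>g\<close>, and primes mark new values. The claim
  follows by comparing the coefficients of \<open>P\<close>, \<open>Q\<close>, \<open>x\<close>,
  \<open>y\<close> and \<open>p\<close> one at a time; the variance is added elsewhere.\<close>

lemma lyapunov_coefficients:
  fixes a b l L \<mu> m P Q x y p q x' y' :: real
  assumes pos: "0 < a" "0 < b" "0 < l" "1 \<le> L" "0 < \<mu>" "\<mu> \<le> L" "a \<le> b" "b \<le> l" "l \<le> 1/4"
    and m: "m \<le> \<mu>h" "m \<le> \<mu>"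
    and nonneg: "0 \<le> P" "0 \<le> Q" "0 \<le> x" "0 \<le> y" "0 \<le> p"
    and step: "56 * L\<^sup>2 * a \<le> \<mu> * b" "320 * L^4 * b \<le> \<mu> * l" "200 * L\<^sup>2 * b \<le> l" "32 * b \<le> \<mu> * l"
    and x': "x' \<le> (1 - a * \<mu>h) * x - a / 2 * (1 - L * a) * p + a * P + a * L\<^sup>2 * y"
    and y': "y' \<le> (1 - b * \<mu>) * y + 17/16 * (4 * b / \<mu> + 2 * b\<^sup>2) * Q + a / 25 * p"
    and q: "q \<le> 2 * Q + 2 * L\<^sup>2 * y"
  shows "(1 - l) * P + (1 - l) * Q + 4 * L\<^sup>2 * (a\<^sup>2 * p + b\<^sup>2 * q) / l + x' + y'
    \<le> (1 - a * m) * (P + Q + x + y)"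
proof -
  have L2: "1 \<le> L\<^sup>2" "L \<le> L\<^sup>2" using pos(4) by (simp_all add: one_le_power self_le_power)
  have bl: "L\<^sup>2 * b \<le> l / 200" using step by simp
  have aL: "L\<^sup>2 * a \<le> L\<^sup>2 * b" using pos by (intro mult_left_mono) auto
  have al: "L\<^sup>2 * a \<le> l / 200" using aL bl by linarith
  have b200: "b \<le> l / 200" using mult_right_mono[OF L2(1), of b] pos bl by linarith
  have La: "L * a \<le> 1/800" using mult_right_mono[OF L2(2), of a] aL bl pos by linarith
  have "m \<le> L\<^sup>2" using m pos L2 by linarith
  \<comment> \<open>The rate \<open>a * m\<close> is thus small against both \<open>l\<close> and
    \<open>b * \<mu>\<close>, so a single \<open>m\<close> can serve all four summands.\<close>
  then have am: "a * m \<le> L\<^sup>2 * a" using pos by (simp add: mult.commute)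
  have c1: "L\<^sup>2 * a\<^sup>2 / l \<le> a / 200"
  proof -
    have "L\<^sup>2 * a * a \<le> l / 200 * a" using al pos by (intro mult_right_mono) auto
    then show ?thesis using pos by (simp add: power2_eq_square field_simps)
  qed
  have c2: "L\<^sup>2 * b\<^sup>2 / l \<le> b / 200"
  proof -
    have "L\<^sup>2 * b * b \<le> l / 200 * b" using bl pos by (intro mult_right_mono) auto
    then show ?thesis using pos by (simp add: power2_eq_square field_simps)
  qed
  have c3: "L^4 * b\<^sup>2 / l \<le> b * \<mu> / 320"
  proof -
    have "320 * L^4 * b * b \<le> \<mu> * l * b" using step pos by (intro mult_right_mono) auto
    then show ?thesis using pos by (simp add: power2_eq_square field_simps)
  qed
  \<comment> \<open>No negative multiple of \<open>q\<close> is available, in contrast to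
    \<open>p\<close>; so \<open>q\<close> is first replaced by its bound in \<open>Q\<close> and
    \<open>y\<close>.\<close>
  have "4 * L\<^sup>2 * (a\<^sup>2 * p + b\<^sup>2 * q) / l \<le> 4 * L\<^sup>2 * (a\<^sup>2 * p + b\<^sup>2 * (2 * Q + 2 * L\<^sup>2 * y)) / l"
    using q pos by (intro divide_right_mono mult_left_mono add_left_mono) auto
  also have "\<dots> = 4 * (L\<^sup>2 * a\<^sup>2 / l) * p + 8 * (L\<^sup>2 * b\<^sup>2 / l) * Q + 8 * (L^4 * b\<^sup>2 / l) * y"
    using pos by (simp add: field_simps power2_eq_square power4_eq_xxxx)
  also have "\<dots> \<le> 4 * (a / 200) * p + 8 * (b / 200) * Q + 8 * (b * \<mu> / 320) * y"
    using c1 c2 c3 nonneg by (intro add_mono mult_right_mono mult_left_mono) auto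
  finally have drift: "4 * L\<^sup>2 * (a\<^sup>2 * p + b\<^sup>2 * q) / l \<le> a / 50 * p + b / 25 * Q + b * \<mu> / 40 * y"
    by (simp add: mult_ac)
  have cP: "(1 - l + a) * P \<le> (1 - a * m) * P"
    using am aL bl b200 pos by (intro mult_right_mono nonneg) linarith
  have cQ: "(1 - l + b / 25 + 17/16 * (4 * b / \<mu> + 2 * b\<^sup>2)) * Q \<le> (1 - a * m) * Q"
  proof (intro mult_right_mono nonneg)
    have "4 * b / \<mu> \<le> l / 8" using step pos by (simp add: field_simps)
    moreover have "b\<^sup>2 \<le> b" using pos by (simp add: power2_eq_square mult_le_cancel_left1)
    ultimately have "17/16 * (4 * b / \<mu> + 2 * b\<^sup>2) \<le> 17/16 * (l / 8 + 2 * (l / 200))"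
      using b200 by (intro mult_left_mono add_mono) auto
    moreover have "1 - l + b / 25 + c \<le> 1 - a * m" if "c \<le> 17/16 * (l / 8 + 2 * (l / 200))" for c
      using that am al b200 pos(3) by (simp add: field_simps)
    ultimately show "1 - l + b / 25 + 17/16 * (4 * b / \<mu> + 2 * b\<^sup>2) \<le> 1 - a * m" by blast
  qed
  have cy: "(1 - b * \<mu> + a * L\<^sup>2 + b * \<mu> / 40) * y \<le> (1 - a * m) * y"
  proof (intro mult_right_mono nonneg)
    have "0 < b * \<mu>" using pos by simp
    then show "1 - b * \<mu> + a * L\<^sup>2 + b * \<mu> / 40 \<le> 1 - a * m"
      using am step(1) by (simp add: mult_ac)
  qed
  have cx: "(1 - a * \<mu>h) * x \<le> (1 - a * m) * x"
    using m pos by (intro mult_right_mono nonneg) auto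
  \<comment> \<open>Operator drift contributes \<open>1/50\<close> and the moving root
    \<open>1/25\<close>, against nearly \<open>1/2\<close> from the descent inequality.\<close>
  have cp: "(a / 50 + a / 25 - a / 2 * (1 - L * a)) * p \<le> 0"
  proof (intro mult_nonpos_nonneg nonneg)
    have "a / 2 * (1 - 1/800) \<le> a / 2 * (1 - L * a)" using La pos by (intro mult_left_mono) auto
    then show "a / 50 + a / 25 - a / 2 * (1 - L * a) \<le> 0" using pos by simp
  qed
  have "(1 - l) * P + (1 - l) * Q + 4 * L\<^sup>2 * (a\<^sup>2 * p + b\<^sup>2 * q) / l + x' + y'
    \<le> (1 - l + a) * P + (1 - l + b / 25 + 17/16 * (4 * b / \<mu> + 2 * b\<^sup>2)) * Q
      + (1 - b * \<mu> + a * L\<^sup>2 + b * \<mu> / 40) * y + (1 - a * \<mu>h) * x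
      + (a / 50 + a / 25 - a / 2 * (1 - L * a)) * p"
    using drift x' y' by (simp only: distrib_right left_diff_distrib)
  also have "\<dots> \<le> (1 - a * m) * P + (1 - a * m) * Q + (1 - a * m) * y + (1 - a * m) * x + 0"
    using cP cQ cy cx cp by (intro add_mono)
  finally show ?thesis by (simp add: algebra_simps)
qed

text \<open>With \<open>n = k + \<tau> + 1\<close>, \<open>v k\<close> carries the weight
  \<open>(n - 1)^2\<close> and \<open>v (Suc k)\<close> the weight \<open>n^2\<close>. Since
  \<open>n^2 * (1 - 2 / n) = (n - 1)^2 - 1\<close>, the weighted value grows by at most
  \<open>C\<close> per step, starting from weight \<open>\<tau>^2\<close>.\<close>

lemma harmonic_rate_recursion:
  fixes v :: "nat \<Rightarrow> real"
  assumes step: "\<And>k. v (Suc k) \<le> (1 - 2 / (real k + \<tau> + 1)) * v k + C / (real k + \<tau> + 1)\<^sup>2"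
    and nonneg: "\<And>k. 0 \<le> v k" and "1 \<le> \<tau>" "0 \<le> C"
  shows "v (Suc k) \<le> C / (real k + \<tau> + 1) + \<tau>\<^sup>2 / (real k + \<tau> + 1)\<^sup>2 * v 0"
proof -
  have scaled: "(real k + \<tau>)\<^sup>2 * v k \<le> \<tau>\<^sup>2 * v 0 + real k * C" for k
  proof (induction k)
    case (Suc k)
    define n where "n = real k + \<tau> + 1"
    have n: "0 < n" using \<open>1 \<le> \<tau>\<close> by (simp add: n_def)
    have "n\<^sup>2 * v (Suc k) \<le> n\<^sup>2 * ((1 - 2 / n) * v k + C / n\<^sup>2)"
      using step[of k] by (intro mult_left_mono) (auto simp: n_def)
    also have "\<dots> = ((n - 1)\<^sup>2 - 1) * v k + C"
      using n by (simp add: field_simps power2_eq_square)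
    also have "\<dots> \<le> (n - 1)\<^sup>2 * v k + C" using nonneg[of k] by (simp add: left_diff_distrib)
    finally show ?case using Suc by (simp add: n_def algebra_simps)
  qed simp
  define n where "n = real k + \<tau> + 1"
  have n: "0 < n" "real (Suc k) \<le> n" using \<open>1 \<le> \<tau>\<close> by (auto simp: n_def)
  have "n\<^sup>2 * v (Suc k) \<le> \<tau>\<^sup>2 * v 0 + real (Suc k) * C"
    using scaled[of "Suc k"] by (simp add: n_def add_ac)
  also have "\<dots> \<le> \<tau>\<^sup>2 * v 0 + n * C"
    using n(2) \<open>0 \<le> C\<close> by (intro add_left_mono mult_right_mono)
  finally have "v (Suc k) \<le> (\<tau>\<^sup>2 * v 0 + n * C) / n\<^sup>2"
    using n by (simp add: pos_le_divide_eq mult.commute)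
  also have "\<dots> = C / n + \<tau>\<^sup>2 / n\<^sup>2 * v 0"
    using n by (simp add: field_simps power2_eq_square)
  finally show ?thesis by (simp add: n_def)
qed

section \<open>Regularity of the operators in parameters and sample\<close>

lemma continuous_on_joint_lipschitz:
  fixes H :: "'a::real_normed_vector \<Rightarrow> 'b::real_normed_vector \<Rightarrow> 'c::real_normed_vector"
  assumes lip: "\<And>t1 t2 w1 w2. norm (H t1 w1 - H t2 w2) \<le> L * (norm (t1 - t2) + norm (w1 - w2))"
    and "0 \<le> L"
  shows "continuous_on UNIV (\<lambda>p. H (fst p) (snd p))"
proof (rule lipschitz_on_continuous_on[where L="2 * L"], rule lipschitz_onI)
  fix p q :: "'a \<times> 'b"
  have "dist (H (fst p) (snd p)) (H (fst q) (snd q)) \<le> L * (dist (fst p) (fst q) + dist (snd p) (snd q))"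
    using lip by (simp add: dist_norm)
  also have "\<dots> \<le> L * (dist p q + dist p q)"
    using \<open>0 \<le> L\<close> by (intro mult_left_mono add_mono dist_fst_le dist_snd_le)
  finally show "dist (H (fst p) (snd p)) (H (fst q) (snd q)) \<le> 2 * L * dist p q" by simp
qed (use \<open>0 \<le> L\<close> in simp)

text \<open>The Lipschitz bound makes \<open>H\<close> a Caratheodory function, which upgrades
  measurability in the sample to joint measurability.\<close>

lemma measurable_jointly_lipschitz:
  fixes H :: "'a::euclidean_space \<Rightarrow> 'b::euclidean_space \<Rightarrow> 's \<Rightarrow> 'c::euclidean_space"
  assumes lip: "jointly_lipschitz \<xi> H L" and "0 \<le> L"
    and meas: "\<And>t w. H t w \<in> borel_measurable \<xi>"
  shows "(\<lambda>(p, x). H (fst p) (snd p) x) \<in> borel_measurable (borel \<Otimes>\<^sub>M \<xi>)"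
proof (rule measurable_Caratheodory[OF meas])
  fix x assume "x \<in> space \<xi>"
  then show "continuous_on UNIV (\<lambda>p. H (fst p) (snd p) x)"
    using lip \<open>0 \<le> L\<close>
    by (intro continuous_on_joint_lipschitz[where L=L]) (auto simp: jointly_lipschitz_def)
qed

section \<open>The Lyapunov function, its one-step contraction and the expected excess\<close>

locale two_time_scale =
  fixes h :: "'a::euclidean_space \<Rightarrow> real" and gh :: "'a \<Rightarrow> 'a" and hstar :: real
    and \<xi> :: "'s measure"
    and F :: "'a \<Rightarrow> 'b::euclidean_space \<Rightarrow> 's \<Rightarrow> 'a" and G :: "'a \<Rightarrow> 'b \<Rightarrow> 's \<Rightarrow> 'b"
    and ws :: "'a \<Rightarrow> 'b" and L B \<mu>G \<mu>h :: real
  assumes grad: "\<And>t. GDERIV h t :> gh t" and hstar_le: "\<And>t. hstar \<le> h t"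
    and prob: "prob_space \<xi>"
    and F_int: "\<And>t w. integrable \<xi> (F t w)" and G_int: "\<And>t w. integrable \<xi> (G t w)"
    and G_root: "\<And>t. mean_op \<xi> G t (ws t) = 0"
    and grad_F: "\<And>t. gh t = mean_op \<xi> F t (ws t)"
    and L: "1 \<le> L"
    and F_lip: "jointly_lipschitz \<xi> F L" and G_lip: "jointly_lipschitz \<xi> G L"
    and grad_lip: "\<And>t1 t2. norm (gh t1 - gh t2) \<le> L * norm (t1 - t2)"
    and ws_lip: "\<And>t1 t2. norm (ws t1 - ws t2) \<le> L * norm (t1 - t2)"
    and B: "0 \<le> B" and F_var: "bounded_variance \<xi> F B" and G_var: "bounded_variance \<xi> G B"
    and \<mu>G: "0 < \<mu>G"
    and mono: "\<And>t w. \<mu>G * (norm (w - ws t))\<^sup>2 \<le> mean_op \<xi> G t w \<bullet> (w - ws t)"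
    and PL: "\<And>t. \<mu>h * (h t - hstar) \<le> 1/2 * (norm (gh t))\<^sup>2"
begin

definition lyapunov :: "'a \<Rightarrow> 'b \<Rightarrow> 'a \<Rightarrow> 'b \<Rightarrow> real" where
  "lyapunov t w f g = (norm (f - mean_op \<xi> F t w))\<^sup>2 + (norm (g - mean_op \<xi> G t w))\<^sup>2
     + (h t - hstar) + (norm (w - ws t))\<^sup>2"

lemma lyapunov_nonneg: "0 \<le> lyapunov t w f g"
  using hstar_le[of t] by (simp add: lyapunov_def)

lemma excess_le_lyapunov: "h t - hstar \<le> lyapunov t w f g"
  by (simp add: lyapunov_def)

lemma continuous_h: "continuous_on UNIV h"
proof -
  have "isCont h t" for t
    using grad[of t] unfolding gderiv_def by (rule has_derivative_continuous)
  then show ?thesis by (simp add: continuous_on_eq_continuous_at)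
qed

text \<open>This supplies the Borel measurability under which the Lyapunov function can be
  integrated along the iterates.\<close>

lemma continuous_lyapunov:
  "continuous_on UNIV (\<lambda>(t, w, f, g). lyapunov t w f g)"
proof -
  have ws: "continuous_on UNIV ws"
    using ws_lip L by (intro lipschitz_on_continuous_on[where L=L] lipschitz_onI) (auto simp: dist_norm)
  have pair: "continuous_on UNIV (\<lambda>z :: 'a \<times> 'b \<times> 'a \<times> 'b. (fst z, fst (snd z)))"
    by (intro continuous_intros)
  have F: "continuous_on UNIV (\<lambda>z :: 'a \<times> 'b \<times> 'a \<times> 'b. mean_op \<xi> F (fst z) (fst (snd z)))"
    using continuous_on_compose2[OF continuous_on_joint_lipschitz[OF mean_op_lipschitz[OF prob F_int F_lip]] pair] L
    by simp
  have G: "continuous_on UNIV (\<lambda>z :: 'a \<times> 'b \<times> 'a \<times> 'b. mean_op \<xi> G (fst z) (fst (snd z)))"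
    using continuous_on_compose2[OF continuous_on_joint_lipschitz[OF mean_op_lipschitz[OF prob G_int G_lip]] pair] L
    by simp
  show ?thesis
    unfolding lyapunov_def case_prod_beta
    by (intro continuous_intros F G continuous_on_compose2[OF continuous_h] continuous_on_compose2[OF ws]) auto
qed

text \<open>Strong monotonicity and the Lipschitz bound are compared at a unit vector away from the
  root.\<close>

lemma \<mu>G_le_L: "\<mu>G \<le> L"
proof -
  obtain e :: 'b where e: "e \<in> Basis" using nonempty_Basis by blast
  have "\<mu>G * (norm e)\<^sup>2 \<le> mean_op \<xi> G 0 (ws 0 + e) \<bullet> e" using mono[of "ws 0 + e" 0] by simp
  also have "\<dots> \<le> norm (mean_op \<xi> G 0 (ws 0 + e) - mean_op \<xi> G 0 (ws 0)) * norm e"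
    by (simp add: G_root norm_cauchy_schwarz)
  also have "\<dots> \<le> L * norm e * norm e"
    using mean_op_lipschitz[OF prob G_int G_lip, of 0 "ws 0 + e" 0 "ws 0"]
    by (intro mult_right_mono) auto
  finally show ?thesis using e by simp
qed

text \<open>The parameters move along the old \<open>f\<close> and \<open>g\<close>, so for a fixed
  current state the sample enters only the two new averages; the excess and the tracking error after
  the step are constants under the integral.\<close>

lemma lyapunov_step:
  assumes step: "0 < a" "a \<le> b" "b \<le> l" "l \<le> 1/4"
    "56 * L\<^sup>2 * a \<le> \<mu>G * b" "320 * L^4 * b \<le> \<mu>G * l" "200 * L\<^sup>2 * b \<le> l" "32 * b \<le> \<mu>G * l" "8 * L\<^sup>2 * b \<le> \<mu>G"
  shows "(\<integral>\<^sup>+x. ennreal (lyapunov (t - a *\<^sub>R f) (w - b *\<^sub>R g)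
        ((1 - l) *\<^sub>R f + l *\<^sub>R F t w x) ((1 - l) *\<^sub>R g + l *\<^sub>R G t w x)) \<partial>\<xi>)
    \<le> ennreal ((1 - a * min \<mu>h \<mu>G) * lyapunov t w f g + 2 * l\<^sup>2 * B)"
proof -
  let ?mF = "mean_op \<xi> F" and ?mG = "mean_op \<xi> G"
  interpret \<xi>: prob_space \<xi> by (rule prob)
  define t' where "t' = t - a *\<^sub>R f"
  define w' where "w' = w - b *\<^sub>R g"
  define P where "P = (norm (f - ?mF t w))\<^sup>2"
  define Q where "Q = (norm (g - ?mG t w))\<^sup>2"
  define y where "y = (norm (w - ws t))\<^sup>2"
  define p where "p = (norm f)\<^sup>2"
  define q where "q = (norm g)\<^sup>2"
  \<comment> \<open>The drift cost of one residual. It occurs for \<open>F\<close> and for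
    \<open>G\<close>, whence the factor \<open>4\<close> in
    \<open>lyapunov_coefficients\<close>.\<close>
  define D where "D = 2 * L\<^sup>2 * (a\<^sup>2 * p + b\<^sup>2 * q) / l"
  have pos: "0 < b" "0 < l" "l \<le> 1" "0 \<le> L" using step L by auto
  have D: "2 * L\<^sup>2 * ((norm (t - t'))\<^sup>2 + (norm (w - w'))\<^sup>2) / l = D"
    by (simp add: t'_def w'_def D_def p_def q_def power_mult_distrib)
  have F: "(\<integral>\<^sup>+x. ennreal ((norm ((1 - l) *\<^sub>R f + l *\<^sub>R F t w x - ?mF t' w'))\<^sup>2) \<partial>\<xi>)
      \<le> ennreal ((1 - l) * P + D + l\<^sup>2 * B)"
    unfolding P_def D[symmetric]
    by (rule tracking_error_step[OF prob F_int F_lip \<open>0 \<le> L\<close> F_var B pos(2,3)])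
  have G: "(\<integral>\<^sup>+x. ennreal ((norm ((1 - l) *\<^sub>R g + l *\<^sub>R G t w x - ?mG t' w'))\<^sup>2) \<partial>\<xi>)
      \<le> ennreal ((1 - l) * Q + D + l\<^sup>2 * B)"
    unfolding Q_def D[symmetric]
    by (rule tracking_error_step[OF prob G_int G_lip \<open>0 \<le> L\<close> G_var B pos(2,3)])
  define c where "c = (h t' - hstar) + (norm (w' - ws t'))\<^sup>2"
  have c: "0 \<le> c" using hstar_le[of t'] by (simp add: c_def)
  have bounds: "0 \<le> (1 - l) * P + D + l\<^sup>2 * B" "0 \<le> (1 - l) * Q + D + l\<^sup>2 * B"
    using pos B by (auto simp: P_def Q_def D_def p_def q_def)
  have [measurable]: "F t w \<in> borel_measurable \<xi>" "G t w \<in> borel_measurable \<xi>"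
    using F_int G_int by auto
  have m_bound: "norm (?mG t w) \<le> L * norm (w - ws t)"
    using mean_op_lipschitz[OF prob G_int G_lip, of t w t "ws t"] by (simp add: G_root)
  have x': "h t' - hstar \<le> (1 - a * \<mu>h) * (h t - hstar) - a / 2 * (1 - L * a) * p + a * P + a * L\<^sup>2 * y"
  proof -
    have "norm (?mF t w - gh t) \<le> L * norm (w - ws t)"
      using mean_op_lipschitz[OF prob F_int F_lip, of t w t "ws t"] by (simp add: grad_F)
    then have "(norm (?mF t w - gh t))\<^sup>2 \<le> L\<^sup>2 * y"
      unfolding y_def power_mult_distrib[symmetric] by (intro power_mono) auto
    \<comment> \<open>The gradient is the mean of \<open>F\<close> at the root, so the error of
      \<open>f\<close> is the residual plus a bias controlled by \<open>y\<close>.\<close>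
    then have "(norm (f - gh t))\<^sup>2 \<le> 2 * P + 2 * (L\<^sup>2 * y)"
      using norm_add_le_twice[of "f - ?mF t w" "?mF t w - gh t"] by (simp add: P_def)
    then have "a / 2 * (norm (f - gh t))\<^sup>2 \<le> a / 2 * (2 * P + 2 * (L\<^sup>2 * y))"
      using step(1) by (intro mult_left_mono) auto
    then show ?thesis
      using PL_descent_step[OF grad grad_lip PL, where a=a and t=t and f=f] step(1)
      unfolding t'_def p_def by (simp add: algebra_simps)
  qed
  have y': "(norm (w' - ws t'))\<^sup>2
      \<le> (1 - b * \<mu>G) * y + 17/16 * (4 * b / \<mu>G + 2 * b\<^sup>2) * Q + a / 25 * p"
  proof -
    have "norm (ws t - ws t') \<le> L * (a * norm f)"
      using ws_lip[of t t'] step(1) by (simp add: t'_def)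
    from strongly_monotone_step[OF mono m_bound this \<mu>G \<mu>G_le_L L pos(1) less_imp_le[OF step(1)] step(9,5), of g]
    show ?thesis by (simp add: w'_def y_def Q_def p_def)
  qed
  have q: "q \<le> 2 * Q + 2 * L\<^sup>2 * y"
  proof -
    have "(norm (?mG t w))\<^sup>2 \<le> L\<^sup>2 * y"
      unfolding y_def power_mult_distrib[symmetric] using m_bound by (intro power_mono) auto
    then show ?thesis
      using norm_add_le_twice[of "g - ?mG t w" "?mG t w"] by (simp add: q_def Q_def)
  qed
  have drift: "(1 - l) * P + (1 - l) * Q + 4 * L\<^sup>2 * (a\<^sup>2 * p + b\<^sup>2 * q) / l + (h t' - hstar) + (norm (w' - ws t'))\<^sup>2
    \<le> (1 - a * min \<mu>h \<mu>G) * (P + Q + (h t - hstar) + y)"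
    by (rule lyapunov_coefficients[OF step(1) pos(1,2) L \<mu>G \<mu>G_le_L step(2-4) _ _ _ _ _ _ _ step(5-8) x' y' q])
      (auto simp: P_def Q_def y_def p_def hstar_le)
  have "(\<integral>\<^sup>+x. ennreal (lyapunov t' w' ((1 - l) *\<^sub>R f + l *\<^sub>R F t w x) ((1 - l) *\<^sub>R g + l *\<^sub>R G t w x)) \<partial>\<xi>)
      = (\<integral>\<^sup>+x. ennreal ((norm ((1 - l) *\<^sub>R f + l *\<^sub>R F t w x - ?mF t' w'))\<^sup>2)
          + ennreal ((norm ((1 - l) *\<^sub>R g + l *\<^sub>R G t w x - ?mG t' w'))\<^sup>2) + ennreal c \<partial>\<xi>)"
    using c by (simp add: lyapunov_def c_def add.assoc flip: ennreal_plus)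
  also have "\<dots> = (\<integral>\<^sup>+x. ennreal ((norm ((1 - l) *\<^sub>R f + l *\<^sub>R F t w x - ?mF t' w'))\<^sup>2) \<partial>\<xi>)
      + (\<integral>\<^sup>+x. ennreal ((norm ((1 - l) *\<^sub>R g + l *\<^sub>R G t w x - ?mG t' w'))\<^sup>2) \<partial>\<xi>) + ennreal c"
    by (simp add: nn_integral_add \<xi>.emeasure_space_1)
  also have "\<dots> \<le> ennreal ((1 - l) * P + D + l\<^sup>2 * B) + ennreal ((1 - l) * Q + D + l\<^sup>2 * B) + ennreal c"
    using F G by (intro add_mono) auto
  also have "\<dots> = ennreal (((1 - l) * P + D + l\<^sup>2 * B) + ((1 - l) * Q + D + l\<^sup>2 * B) + c)"
    using bounds c by (simp only: ennreal_plus add_nonneg_nonneg)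
  also have "\<dots> \<le> ennreal ((1 - a * min \<mu>h \<mu>G) * lyapunov t w f g + 2 * l\<^sup>2 * B)"
  proof (rule ennreal_leI)
    have "2 * D = 4 * L\<^sup>2 * (a\<^sup>2 * p + b\<^sup>2 * q) / l" by (simp add: D_def)
    then show "(1 - l) * P + D + l\<^sup>2 * B + ((1 - l) * Q + D + l\<^sup>2 * B) + c
        \<le> (1 - a * min \<mu>h \<mu>G) * lyapunov t w f g + 2 * l\<^sup>2 * B"
      using drift unfolding lyapunov_def c_def P_def[symmetric] Q_def[symmetric] y_def[symmetric] by linarith
  qed
  finally show ?thesis unfolding t'_def w'_def .
qed

lemma measurable_update:
  "(\<lambda>((t, w, f, g), x). (t - a *\<^sub>R f, w - b *\<^sub>R g,
      (1 - l) *\<^sub>R f + l *\<^sub>R F t w x, (1 - l) *\<^sub>R g + l *\<^sub>R G t w x)) \<in> borel \<Otimes>\<^sub>M \<xi> \<rightarrow>\<^sub>M borel"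
proof -
  let ?N = "(borel :: ('a \<times> 'b \<times> 'a \<times> 'b) measure) \<Otimes>\<^sub>M \<xi>"
  have t: "(\<lambda>z. fst (fst z)) \<in> borel_measurable ?N"
    and w: "(\<lambda>z. fst (snd (fst z))) \<in> borel_measurable ?N"
    and f: "(\<lambda>z. fst (snd (snd (fst z)))) \<in> borel_measurable ?N"
    and g: "(\<lambda>z. snd (snd (snd (fst z)))) \<in> borel_measurable ?N"
    by (auto intro!: measurable_compose[OF measurable_fst] borel_measurable_continuous_onI continuous_intros)
  have args: "(\<lambda>z. ((fst (fst z), fst (snd (fst z))), snd z)) \<in> ?N \<rightarrow>\<^sub>M borel \<Otimes>\<^sub>M \<xi>"
    by (intro measurable_Pair borel_measurable_Pair t w measurable_snd)
  have F: "(\<lambda>z. F (fst (fst z)) (fst (snd (fst z))) (snd z)) \<in> borel_measurable ?N"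
    using measurable_compose[OF args measurable_jointly_lipschitz[OF F_lip]] L F_int by auto
  have G: "(\<lambda>z. G (fst (fst z)) (fst (snd (fst z))) (snd z)) \<in> borel_measurable ?N"
    using measurable_compose[OF args measurable_jointly_lipschitz[OF G_lip]] L G_int by auto
  show ?thesis
    unfolding case_prod_beta
    by (intro borel_measurable_Pair borel_measurable_diff borel_measurable_add borel_measurable_scaleR
        borel_measurable_const t w f g F G)
qed

text \<open>Expectations of the Lyapunov function stay nonnegative extended integrals, so iterating
  the contraction presupposes no integrability; only the final excess is turned into a real
  integral.\<close>

lemma excess_bound:
  fixes M :: "'p measure" and \<theta> f :: "nat \<Rightarrow> 'p \<Rightarrow> 'a" and \<omega> g :: "nat \<Rightarrow> 'p \<Rightarrow> 'b"
    and \<alpha> \<beta> lam :: "nat \<Rightarrow> real"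
  assumes M: "prob_space M" and X_indep: "prob_space.indep_vars M (\<lambda>_. \<xi>) X UNIV"
    and X_distr: "\<And>k. distr M \<xi> (X k) = \<xi>"
    and init: "\<And>s. s \<in> space M \<Longrightarrow> \<theta> 0 s = \<theta>0" "\<And>s. s \<in> space M \<Longrightarrow> \<omega> 0 s = \<omega>0"
      "\<And>s. s \<in> space M \<Longrightarrow> f 0 s = f0" "\<And>s. s \<in> space M \<Longrightarrow> g 0 s = g0"
    and Suc: "\<And>k s. s \<in> space M \<Longrightarrow> \<theta> (Suc k) s = \<theta> k s - \<alpha> k *\<^sub>R f k s"
      "\<And>k s. s \<in> space M \<Longrightarrow> \<omega> (Suc k) s = \<omega> k s - \<beta> k *\<^sub>R g k s"
      "\<And>k s. s \<in> space M \<Longrightarrow> f (Suc k) s = (1 - lam k) *\<^sub>R f k s + lam k *\<^sub>R F (\<theta> k s) (\<omega> k s) (X k s)"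
      "\<And>k s. s \<in> space M \<Longrightarrow> g (Suc k) s = (1 - lam k) *\<^sub>R g k s + lam k *\<^sub>R G (\<theta> k s) (\<omega> k s) (X k s)"
    and step: "\<And>k. 0 < \<alpha> k" "\<And>k. \<alpha> k \<le> \<beta> k" "\<And>k. \<beta> k \<le> lam k" "\<And>k. lam k \<le> 1/4"
      "\<And>k. 56 * L\<^sup>2 * \<alpha> k \<le> \<mu>G * \<beta> k" "\<And>k. 320 * L^4 * \<beta> k \<le> \<mu>G * lam k"
      "\<And>k. 200 * L\<^sup>2 * \<beta> k \<le> lam k" "\<And>k. 32 * \<beta> k \<le> \<mu>G * lam k" "\<And>k. 8 * L\<^sup>2 * \<beta> k \<le> \<mu>G"
    and rate: "\<And>k. 2 / (real k + \<tau> + 1) \<le> \<alpha> k * min \<mu>h \<mu>G"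
    and noise: "\<And>k. 2 * (lam k)\<^sup>2 \<le> \<tau>\<^sup>2 / (real k + \<tau> + 1)\<^sup>2" and \<tau>: "1 \<le> \<tau>"
  shows "integrable M (\<lambda>s. h (\<theta> (Suc k) s) - hstar)"
    and "(LINT s|M. h (\<theta> (Suc k) s) - hstar)
      \<le> B * \<tau>\<^sup>2 / (real k + \<tau> + 1) + \<tau>\<^sup>2 / (real k + \<tau> + 1)\<^sup>2 * lyapunov \<theta>0 \<omega>0 f0 g0"
proof -
  interpret M: prob_space M by fact
  interpret \<xi>: prob_space \<xi> by (rule prob)
  define T where "T k = (\<lambda>(t, w, f, g) x. (t - \<alpha> k *\<^sub>R f, w - \<beta> k *\<^sub>R g,
      (1 - lam k) *\<^sub>R f + lam k *\<^sub>R F t w x, (1 - lam k) *\<^sub>R g + lam k *\<^sub>R G t w x))" for k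
  define Z where "Z k s = (\<theta> k s, \<omega> k s, f k s, g k s)" for k s
  define V where "V = (\<lambda>(t, w, f, g). lyapunov t w f g)"
  have V_nonneg: "0 \<le> V z" for z by (simp add: V_def lyapunov_nonneg split: prod.split)
  have V_meas: "(\<lambda>z. ennreal (V z)) \<in> borel_measurable borel"
    unfolding V_def
    by (rule measurable_compose[OF borel_measurable_continuous_onI[OF continuous_lyapunov] measurable_ennreal])
  have T_meas: "(\<lambda>(z, x). T k z x) \<in> borel \<Otimes>\<^sub>M \<xi> \<rightarrow>\<^sub>M borel" for k
    using measurable_update[of "\<alpha> k" "\<beta> k" "lam k"] by (simp add: T_def split_beta')
  note chain = measurable_iid_recursion[OF M X_indep X_distr T_meas, of "(\<theta>0, \<omega>0, f0, g0)" Z]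
  have Z_meas: "Z k \<in> borel_measurable M" for k
    by (rule chain(1)) (auto simp: Z_def T_def init Suc)
  have Z_Suc: "(\<integral>\<^sup>+s. ennreal (V (Z (Suc k) s)) \<partial>M) = (\<integral>\<^sup>+s. (\<integral>\<^sup>+x. ennreal (V (T k (Z k s) x)) \<partial>\<xi>) \<partial>M)" for k
    by (rule chain(2)[OF _ _ _ V_meas]) (auto simp: Z_def T_def init Suc)
  define n where "n k = real k + \<tau> + 1" for k
  \<comment> \<open>This makes the factor \<open>1 - 2 / n k\<close> nonnegative, as multiplication
    in \<open>ennreal\<close> demands.\<close>
  have n: "2 \<le> n k" for k using \<tau> by (simp add: n_def)
  define C where "C = B * \<tau>\<^sup>2"
  have C: "0 \<le> C" using B by (simp add: C_def)
  have contraction: "(\<integral>\<^sup>+x. ennreal (V (T k z x)) \<partial>\<xi>) \<le> ennreal (1 - 2 / n k) * ennreal (V z) + ennreal (C / (n k)\<^sup>2)" for k z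
  proof -
    obtain t w f g where z: "z = (t, w, f, g)" by (cases z)
    have "(\<integral>\<^sup>+x. ennreal (V (T k z x)) \<partial>\<xi>) \<le> ennreal ((1 - \<alpha> k * min \<mu>h \<mu>G) * lyapunov t w f g + 2 * (lam k)\<^sup>2 * B)"
      using lyapunov_step[OF step[of k]] by (simp add: z V_def T_def)
    also have "\<dots> \<le> ennreal ((1 - 2 / n k) * V z + C / (n k)\<^sup>2)"
    proof (intro ennreal_leI add_mono)
      show "(1 - \<alpha> k * min \<mu>h \<mu>G) * lyapunov t w f g \<le> (1 - 2 / n k) * V z"
        using rate[of k] unfolding z V_def by (auto simp: n_def intro!: mult_right_mono lyapunov_nonneg)
      show "2 * (lam k)\<^sup>2 * B \<le> C / (n k)\<^sup>2"
        using mult_right_mono[OF noise[of k] B] by (simp add: n_def C_def mult_ac)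
    qed
    also have "\<dots> = ennreal (1 - 2 / n k) * ennreal (V z) + ennreal (C / (n k)\<^sup>2)"
      using n[of k] V_nonneg C by (subst ennreal_plus) (auto simp: ennreal_mult)
    finally show ?thesis .
  qed
  \<comment> \<open>A deterministic majorant satisfying the recursion with equality. The real-valued
    rate lemma is applied to \<open>u\<close>, not to the expectations.\<close>
  define u where "u = rec_nat (V (\<theta>0, \<omega>0, f0, g0)) (\<lambda>k r. (1 - 2 / n k) * r + C / (n k)\<^sup>2)"
  have u_Suc: "u (Suc k) = (1 - 2 / n k) * u k + C / (n k)\<^sup>2" for k by (simp add: u_def)
  have u_nonneg: "0 \<le> u k" for k
  proof (induction k)
    case (Suc k)
    then show ?case using n[of k] C by (auto simp: u_Suc intro!: add_nonneg_nonneg mult_nonneg_nonneg)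
  qed (simp add: u_def V_nonneg)
  have V_le: "(\<integral>\<^sup>+s. ennreal (V (Z k s)) \<partial>M) \<le> ennreal (u k)" for k
  proof (induction k)
    case 0
    have "(\<integral>\<^sup>+s. ennreal (V (Z 0 s)) \<partial>M) = (\<integral>\<^sup>+s. ennreal (u 0) \<partial>M)"
      by (intro nn_integral_cong) (simp add: Z_def init u_def)
    then show ?case by (simp add: M.emeasure_space_1)
  next
    case (Suc k)
    have VZ: "(\<lambda>s. ennreal (V (Z k s))) \<in> borel_measurable M" by (rule measurable_compose[OF Z_meas V_meas])
    have "(\<integral>\<^sup>+s. ennreal (V (Z (Suc k) s)) \<partial>M)
        \<le> (\<integral>\<^sup>+s. ennreal (1 - 2 / n k) * ennreal (V (Z k s)) + ennreal (C / (n k)\<^sup>2) \<partial>M)"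
      unfolding Z_Suc by (intro nn_integral_mono contraction)
    also have "\<dots> = ennreal (1 - 2 / n k) * (\<integral>\<^sup>+s. ennreal (V (Z k s)) \<partial>M) + ennreal (C / (n k)\<^sup>2)"
      using VZ by (simp add: nn_integral_add nn_integral_cmult M.emeasure_space_1)
    also have "\<dots> \<le> ennreal (1 - 2 / n k) * ennreal (u k) + ennreal (C / (n k)\<^sup>2)"
      by (intro add_right_mono mult_left_mono Suc) simp
    also have "\<dots> = ennreal (u (Suc k))"
      unfolding u_Suc using n[of k] u_nonneg C by (subst ennreal_plus) (auto simp: ennreal_mult)
    finally show ?case .
  qed
  let ?x = "\<lambda>s. h (\<theta> (Suc k) s) - hstar"
  have "(\<lambda>s. fst (Z (Suc k) s)) \<in> borel_measurable M"
    by (intro measurable_compose[OF Z_meas] borel_measurable_continuous_onI continuous_intros)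
  then have "\<theta> (Suc k) \<in> borel_measurable M" by (simp add: Z_def)
  then have x_meas: "?x \<in> borel_measurable M"
    by (intro borel_measurable_diff borel_measurable_const
        measurable_compose[OF _ borel_measurable_continuous_onI[OF continuous_h]])
  have "(\<integral>\<^sup>+s. ennreal (?x s) \<partial>M) \<le> (\<integral>\<^sup>+s. ennreal (V (Z (Suc k) s)) \<partial>M)"
    by (intro nn_integral_mono ennreal_leI) (simp add: V_def Z_def excess_le_lyapunov)
  then have x_le: "(\<integral>\<^sup>+s. ennreal (?x s) \<partial>M) \<le> ennreal (u (Suc k))" using V_le by (rule order_trans)
  \<comment> \<open>The finite majorant gives integrability first; then the Bochner integral agrees
    with the extended one and inherits its bound.\<close>
  have "(\<integral>\<^sup>+s. ennreal (norm (?x s)) \<partial>M) = (\<integral>\<^sup>+s. ennreal (?x s) \<partial>M)" by (simp add: hstar_le)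
  also have "\<dots> < \<infinity>" using x_le by (simp add: le_less_trans)
  finally show int: "integrable M ?x" using x_meas by (intro integrableI_bounded)
  have "(LINT s|M. ?x s) \<le> u (Suc k)"
    using x_le u_nonneg int by (simp add: nn_integral_eq_integral hstar_le)
  also have "u (Suc k) \<le> C / (real k + \<tau> + 1) + \<tau>\<^sup>2 / (real k + \<tau> + 1)\<^sup>2 * u 0"
    by (rule harmonic_rate_recursion) (auto simp: u_Suc n_def u_nonneg \<tau> C simp del: of_nat_Suc)
  finally show "(LINT s|M. ?x s)
      \<le> B * \<tau>\<^sup>2 / (real k + \<tau> + 1) + \<tau>\<^sup>2 / (real k + \<tau> + 1)\<^sup>2 * lyapunov \<theta>0 \<omega>0 f0 g0"
    by (simp add: C_def u_def V_def)
qed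

end

section \<open>From the stated step sizes to the rate\<close>

text \<open>Integrability belongs to the conclusion because the Bochner integral of a non-integrable
  function is \<open>0\<close>, which would satisfy the bound trivially.\<close>

theorem theorem2:
  fixes h :: "real ^ 'd \<Rightarrow> real" and grad_h :: "real ^ 'd \<Rightarrow> real ^ 'd" and hstar :: real
    and \<xi> :: "'s measure"
    and F :: "real ^ 'd \<Rightarrow> real ^ 'r \<Rightarrow> 's \<Rightarrow> real ^ 'd"
    and G :: "real ^ 'd \<Rightarrow> real ^ 'r \<Rightarrow> 's \<Rightarrow> real ^ 'r"
    and \<omega>star :: "real ^ 'd \<Rightarrow> real ^ 'r"
    and L B \<mu>G \<mu>h :: real
    and M :: "'p measure" and X :: "nat \<Rightarrow> 'p \<Rightarrow> 's"
    and \<theta>0 f0 :: "real ^ 'd" and \<omega>0 g0 :: "real ^ 'r"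
    and \<theta> f :: "nat \<Rightarrow> 'p \<Rightarrow> real ^ 'd" and \<omega> g :: "nat \<Rightarrow> 'p \<Rightarrow> real ^ 'r"
    and lam \<alpha> \<beta> :: "nat \<Rightarrow> real" and c_lam c_\<alpha> c_\<beta> \<tau> :: real
  assumes grad: "\<And>t. GDERIV h t :> grad_h t"
    and grad_cont: "continuous_on UNIV grad_h"
    and min_attained: "\<exists>t. h t = hstar" and min_le: "\<And>t. hstar \<le> h t"
    and prob_\<xi>: "prob_space \<xi>"
    and F_int: "\<And>t w. integrable \<xi> (F t w)"
    and G_int: "\<And>t w. integrable \<xi> (G t w)"
    and \<omega>star: "\<And>t w. mean_op \<xi> G t w = 0 \<longleftrightarrow> w = \<omega>star t"
    and grad_F: "\<And>t. grad_h t = mean_op \<xi> F t (\<omega>star t)"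
    and L: "L \<ge> 1"
    and F_lip: "jointly_lipschitz \<xi> F L"
    and G_lip: "jointly_lipschitz \<xi> G L"
    and grad_lip: "\<And>t1 t2. norm (grad_h t1 - grad_h t2) \<le> L * norm (t1 - t2)"
    and \<omega>star_lip: "\<And>t1 t2. norm (\<omega>star t1 - \<omega>star t2) \<le> L * norm (t1 - t2)"
    and B: "B > 0"
    and F_var: "bounded_variance \<xi> F B"
    and G_var: "bounded_variance \<xi> G B"
    and \<mu>G: "\<mu>G > 0"
    and strong_mono: "\<And>t w. mean_op \<xi> G t w \<bullet> (w - \<omega>star t) \<ge> \<mu>G * (norm (w - \<omega>star t))\<^sup>2"
    and \<mu>h: "\<mu>h > 0"
    and PL: "\<And>t. 1/2 * (norm (grad_h t))\<^sup>2 \<ge> \<mu>h * (h t - hstar)"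
    and prob_M: "prob_space M"
    and X_indep: "prob_space.indep_vars M (\<lambda>_. \<xi>) X UNIV"
    and X_distr: "\<And>k. distr M \<xi> (X k) = \<xi>"
    and \<theta>_0: "\<And>s. s \<in> space M \<Longrightarrow> \<theta> 0 s = \<theta>0"
    and \<omega>_0: "\<And>s. s \<in> space M \<Longrightarrow> \<omega> 0 s = \<omega>0"
    and f_0: "\<And>s. s \<in> space M \<Longrightarrow> f 0 s = f0"
    and g_0: "\<And>s. s \<in> space M \<Longrightarrow> g 0 s = g0"
    and \<theta>_Suc: "\<And>k s. s \<in> space M \<Longrightarrow> \<theta> (Suc k) s = \<theta> k s - \<alpha> k *\<^sub>R f k s"
    and \<omega>_Suc: "\<And>k s. s \<in> space M \<Longrightarrow> \<omega> (Suc k) s = \<omega> k s - \<beta> k *\<^sub>R g k s"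
    and f_Suc: "\<And>k s. s \<in> space M \<Longrightarrow>
      f (Suc k) s = (1 - lam k) *\<^sub>R f k s + lam k *\<^sub>R F (\<theta> k s) (\<omega> k s) (X k s)"
    and g_Suc: "\<And>k s. s \<in> space M \<Longrightarrow>
      g (Suc k) s = (1 - lam k) *\<^sub>R g k s + lam k *\<^sub>R G (\<theta> k s) (\<omega> k s) (X k s)"
    and c_pos: "c_lam > 0" "c_\<alpha> > 0" "c_\<beta> > 0" "\<tau> \<ge> 1"
    and lam: "\<And>k. lam k = c_lam / (real k + \<tau> + 1)"
    and \<alpha>: "\<And>k. \<alpha> k = c_\<alpha> / (real k + \<tau> + 1)"
    and \<beta>: "\<And>k. \<beta> k = c_\<beta> / (real k + \<tau> + 1)"
    and c_\<alpha>: "c_\<alpha> \<ge> 2 / min \<mu>h \<mu>G"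
    and step_order: "\<And>k. \<alpha> k \<le> \<beta> k" "\<And>k. \<beta> k \<le> lam k" "\<And>k. lam k \<le> 1/4"
    and \<beta>_le: "\<And>k. \<beta> k \<le> Min {1 / L,
                              \<mu>G / (320 * L^4) * lam k,
                              \<mu>h^3 / (480 * (L + 1)^6),
                              \<mu>G / (8 * L^2),
                              lam k / 4 * inverse (2 * L^2 / \<mu>h^3 + 58 * L^2),
                              lam k / 4 * inverse (50 * L^2 + 8 / \<mu>G)}"
    and \<alpha>_le: "\<And>k. \<alpha> k \<le> min (\<mu>G * \<beta> k / (4 * (14 * L^3 + 132 * (L + 1)^6 / \<mu>h^3)))
                              (\<mu>h^2 / (3072 * (L + 1)^6) * lam k)"
  shows "\<forall>k. integrable M (\<lambda>s. h (\<theta> (Suc k) s) - hstar) \<and>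
    (LINT s|M. h (\<theta> (Suc k) s) - hstar)
      \<le> B * \<tau>^2 / (real k + \<tau> + 1)
        + \<tau>^2 / (real k + \<tau> + 1)^2 *
          ((norm (f0 - mean_op \<xi> F \<theta>0 \<omega>0))\<^sup>2 + (norm (g0 - mean_op \<xi> G \<theta>0 \<omega>0))\<^sup>2
           + (h \<theta>0 - hstar) + (norm (\<omega>0 - \<omega>star \<theta>0))\<^sup>2)"
proof -
  interpret two_time_scale h grad_h hstar \<xi> F G \<omega>star L B \<mu>G \<mu>h
  proof (rule two_time_scale.intro)
    show "mean_op \<xi> G t (\<omega>star t) = 0" for t using \<omega>star by simp
    show "0 \<le> B" using B by simp
  qed (rule grad min_le prob_\<xi> F_int G_int grad_F L F_lip G_lip grad_lip \<omega>star_lip F_var G_var \<mu>G strong_mono PL)+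
  have pos: "0 < \<alpha> k" "0 < \<beta> k" "0 < lam k" for k
    using c_pos by (auto simp: \<alpha> \<beta> lam)
  have \<beta>_le': "\<beta> k \<le> \<mu>G / (320 * L^4) * lam k" "\<beta> k \<le> \<mu>G / (8 * L\<^sup>2)"
    "\<beta> k \<le> lam k / 4 * inverse (50 * L\<^sup>2 + 8 / \<mu>G)" for k
    using \<beta>_le[of k] by simp_all
  have L_powers: "1 \<le> L\<^sup>2" "L\<^sup>2 \<le> L^3"
    using L by (auto intro: one_le_power power_increasing)
  have denom: "(50 * L\<^sup>2 + 8 / \<mu>G) * \<beta> k \<le> lam k / 4" for k
  proof -
    have d: "0 < 50 * L\<^sup>2 + 8 / \<mu>G" using L \<mu>G by (intro add_pos_pos) auto
    then show ?thesis using \<beta>_le'(3)[of k] by (simp add: field_simps)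
  qed
  \<comment> \<open>The first bound on \<open>\<alpha> k\<close> gives the first condition, as
    \<open>4 * 14 * L^3 \<ge> 56 * L^2\<close>. The third and fourth come from \<open>denom\<close>
    by dropping one summand each; the other two are direct entries of the minimum.\<close>
  have step: "56 * L\<^sup>2 * \<alpha> k \<le> \<mu>G * \<beta> k" "320 * L^4 * \<beta> k \<le> \<mu>G * lam k"
    "200 * L\<^sup>2 * \<beta> k \<le> lam k" "32 * \<beta> k \<le> \<mu>G * lam k" "8 * L\<^sup>2 * \<beta> k \<le> \<mu>G" for k
  proof -
    let ?d = "4 * (14 * L^3 + 132 * (L + 1)^6 / \<mu>h^3)"
    have r: "0 \<le> 132 * (L + 1)^6 / \<mu>h^3" using L \<mu>h by simp
    then have d: "56 * L\<^sup>2 \<le> ?d" using L_powers by simp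
    then have d0: "0 < ?d" using L_powers by linarith
    have "\<alpha> k \<le> \<mu>G * \<beta> k / ?d" using \<alpha>_le[of k] by simp
    then have "\<alpha> k * ?d \<le> \<mu>G * \<beta> k" using d0 by (simp only: pos_le_divide_eq)
    moreover have "56 * L\<^sup>2 * \<alpha> k \<le> ?d * \<alpha> k" using d pos(1)[of k] by (intro mult_right_mono) auto
    ultimately show "56 * L\<^sup>2 * \<alpha> k \<le> \<mu>G * \<beta> k" by (simp only: mult.commute)
    show "320 * L^4 * \<beta> k \<le> \<mu>G * lam k" using \<beta>_le'(1)[of k] L by (simp add: field_simps)
    show "8 * L\<^sup>2 * \<beta> k \<le> \<mu>G" using \<beta>_le'(2)[of k] L by (simp add: field_simps)
    have nonneg: "0 \<le> L\<^sup>2 * \<beta> k" "0 \<le> 8 / \<mu>G * \<beta> k" using pos(2)[of k] \<mu>G by auto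
    have sum: "50 * (L\<^sup>2 * \<beta> k) + 8 / \<mu>G * \<beta> k \<le> lam k / 4"
      using denom[of k] by (simp only: distrib_right mult.assoc)
    show "200 * L\<^sup>2 * \<beta> k \<le> lam k" using sum nonneg by linarith
    have "8 / \<mu>G * \<beta> k \<le> lam k / 4" using sum nonneg by linarith
    then show "32 * \<beta> k \<le> \<mu>G * lam k" using \<mu>G by (simp add: field_simps)
  qed
  have rate: "2 / (real k + \<tau> + 1) \<le> \<alpha> k * min \<mu>h \<mu>G" for k
  proof -
    have "2 \<le> c_\<alpha> * min \<mu>h \<mu>G"
      using c_\<alpha> \<mu>h \<mu>G by (subst (asm) pos_divide_le_eq) auto
    then have "2 / (real k + \<tau> + 1) \<le> c_\<alpha> * min \<mu>h \<mu>G / (real k + \<tau> + 1)"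
      using c_pos by (intro divide_right_mono) auto
    then show ?thesis by (simp add: \<alpha>)
  qed
  have noise: "2 * (lam k)\<^sup>2 \<le> \<tau>\<^sup>2 / (real k + \<tau> + 1)\<^sup>2" for k
  proof -
    \<comment> \<open>The bound \<open>lam k \<le> 1/4\<close> at \<open>k = 0\<close> limits
      \<open>c_lam\<close>; with \<open>\<tau> \<ge> 1\<close> it yields
      \<open>c_lam \<le> \<tau> / 2\<close>. This is how \<open>\<tau>^2\<close> enters the variance
      term.\<close>
    have "c_lam \<le> (\<tau> + 1) / 4" using step_order(3)[of 0] c_pos by (simp add: lam field_simps)
    then have "c_lam \<le> \<tau> / 2" using c_pos by simp
    then have "c_lam\<^sup>2 \<le> (\<tau> / 2)\<^sup>2" using c_pos by (intro power_mono) auto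
    then have "4 * c_lam\<^sup>2 \<le> \<tau>\<^sup>2" by (simp add: power_divide)
    then have "2 * c_lam\<^sup>2 \<le> \<tau>\<^sup>2" using zero_le_power2[of c_lam] by linarith
    then show ?thesis unfolding lam power_divide by (simp add: divide_right_mono)
  qed
  note bound = excess_bound[OF prob_M X_indep X_distr \<theta>_0 \<omega>_0 f_0 g_0 \<theta>_Suc \<omega>_Suc f_Suc g_Suc
      pos(1) step_order step rate noise c_pos(4)]
  show ?thesis
    using bound unfolding lyapunov_def by blast
qed

end
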